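(* Let $\sigma\in[\frac12,1)$ and let $\omega:[0,+\infty)\to[0,+\infty]$ be a non-decreasing function satisfying $\omega\left(\frac12\right)<\infty$. Suppose that for every $m\in\mathbb N$ and every integer $n\in(m,m^{1/\sigma})$ we have $$|G(n,m)|\le\left(m^{\sigma}+\frac{n^{\sigma}}{\sqrt{\log n}}+\left(\frac nm\right)^{\frac{\sigma}{1-\sigma}}\right)\cdot\omega\left(m\left|\sum_{k=1}^m\frac{\mu(k)}{k}\right|\right).$$ Then the Riemann zeta function has no zeros in the region $\{s\in\mathbb C:\ \Re(s)>\sigma\}$.
   Context: $\mathbb N=\{1,2,3,\dots\}$, $\mu$ is the Möbius function, $\lfloor x\rfloor$ is the integer part of $x$, and for $n,m\in\mathbb N$, $$G(n,m)=\sum_{k=1}^m\mu(k)\left\lfloor\frac nk\right\rfloor.$$ The Riemann zeta function is understood as analytically continued to $\mathbb C\setminus\{1\}$. *)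

theory Defs
  imports
    "HOL-Complex_Analysis.Complex_Analysis"
    "HOL-Computational_Algebra.Squarefree"
    "HOL-Library.Extended_Nonnegative_Real"
begin

definition moebius_mu :: "nat \<Rightarrow> int" where
  "moebius_mu n = (if squarefree n then (-1) ^ card (prime_factors n) else 0)"

(* The analytic continuation to the connected open set - {1} of the Dirichlet series
   sum n powr (-s), Re s > 1.  The function chosen is unique on - {1} by the identity theorem;
   its value at the pole 1 is unspecified. *)
definition riemann_zeta :: "complex \<Rightarrow> complex" where
  "riemann_zeta = (SOME f. f holomorphic_on (- {1}) \<and>
     (\<forall>s. Re s > 1 \<longrightarrow> (\<lambda>n. of_nat (Suc n) powr (- s)) sums f s))"

definition G :: "nat \<Rightarrow> nat \<Rightarrow> int" where
  "G n m = (\<Sum>k=1..m. moebius_mu k * \<lfloor>real n / real k\<rfloor>)"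

end

theory Submission
  imports Defs
begin

text \<open>
  Put \<open>g m = (\<Sum>k=1..m. \<mu>(k) / k)\<close>. The coefficients \<open>A n m = G n m - n * g m\<close> are sums of
  \<open>m\<close> rounding errors \<open>\<lfloor>n / k\<rfloor> - n / k\<close> weighted with \<open>\<mu>(k)\<close>, hence bounded by \<open>m\<close>. Summation by parts and
  analytic continuation show that for \<open>Re s > 0\<close>, \<open>s \<noteq> 1\<close>
  \[ \sum_{n \ge 1} A(n,m) \left(n^{-s} - (n+1)^{-s}\right)
       = \zeta(s) \sum_{k \le m} \mu(k) \left(k^{-s} - k^{-1}\right), \]
  so at a zero of zeta the left-hand side is \<open>0\<close> for every \<open>m\<close>
  (\<open>zeta_floor_series\<close>, \<open>G_series_at_zeta_zero\<close>).

  Call \<open>m\<close> good if \<open>m * \<bar>g m\<bar> \<le> 1 / 2\<close>. For good \<open>m\<close> the hypothesis bounds \<open>G n m\<close> with a constant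
  depending only on \<open>\<omega> (1 / 2)\<close>, and the range of \<open>n\<close> and the exponents in it are such that
  \<open>\<bar>A n m\<bar>\<close> is at most a constant times \<open>n powr \<sigma>\<close> for all \<open>n\<close>, uniformly in \<open>m\<close>
  (\<open>G_error_bound\<close>). On the other hand \<open>G n m = 1\<close> for \<open>n \<le> m\<close>, so \<open>A n m\<close> tends to \<open>1\<close> as \<open>m\<close>
  runs to infinity through good values. If \<open>Re s > \<sigma>\<close>, dominated convergence turns the vanishing
  series into
  \[ 0 = \sum_{n \ge 1} \left(n^{-s} - (n+1)^{-s}\right) = 1, \]
  a contradiction (\<open>zeta_nonzero_if_G_bound\<close>).

  It remains to see that there are infinitely many good \<open>m\<close>
  (\<open>moebius_recip_sum_frequently_small\<close>). Otherwise \<open>g\<close> would eventually have constant sign and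
  satisfy \<open>\<bar>g m\<bar> > 1 / (2 * m)\<close>; but the Lambert series identity
  \[ \sum_{k \ge 1} \mu(k) \frac{q^k}{1 - q^k} = q \]
  has, after summation by parts, a left-hand side that is a sum of the values \<open>g k\<close> with positive
  weights, each of which tends to \<open>1 / 2\<close> as \<open>q\<close> tends to \<open>1\<close>; so it would diverge logarithmically.

  Finally, the continuation of zeta to the punctured plane has to be constructed
  (\<open>zeta_continuation\<close>): expanding \<open>(n + 1) powr (1 - s)\<close> in powers of \<open>1 / n\<close> and summing over \<open>n\<close>
  expresses zeta at \<open>s\<close> through its values at \<open>s + 1, s + 2, ...\<close> and a series that converges in
  a larger half-plane.
\<close>

section \<open>Series of holomorphic functions on half-planes\<close>

text \<open>
  The \<open>n\<close>-th term is attached to the integer \<open>n + 1\<close>, so that Dirichlet series become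
  series over all of \<open>nat\<close>.
\<close>
definition recip_powr :: "nat \<Rightarrow> complex \<Rightarrow> complex" where
  "recip_powr n s = of_nat (Suc n) powr (- s)"

lemma recip_powr_0 [simp]: "recip_powr 0 s = 1"
  by (simp add: recip_powr_def)

lemma norm_recip_powr: "norm (recip_powr n s) = real (Suc n) powr (- Re s)"
  unfolding recip_powr_def by (subst norm_powr_real_powr) (auto simp del: of_nat_Suc)

lemma holomorphic_on_recip_powr [holomorphic_intros]:
  "f holomorphic_on S \<Longrightarrow> (\<lambda>s. recip_powr n (f s)) holomorphic_on S"
  unfolding recip_powr_def by (intro holomorphic_intros)

lemma recip_powr_tendsto_0:
  assumes "Re s > 0"
  shows "(\<lambda>n. recip_powr n s) \<longlonglongrightarrow> 0"
  unfolding recip_powr_def using assms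
  by (intro tendsto_neg_powr_complex_of_nat filterlim_Suc) auto

lemma summable_Suc_powr_iff: "summable (\<lambda>n. real (Suc n) powr a) \<longleftrightarrow> a < -1"
  using summable_Suc_iff[of "\<lambda>n. real n powr a"] summable_real_powr_iff[of a] by simp

text \<open>
  The Weierstrass M-test in the only shape needed here: on a small disc in the half-plane the
  factor \<open>K\<close> is bounded by compactness, and the exponent stays strictly below \<open>-1\<close>.
\<close>
lemma halfplane_series:
  fixes f :: "nat \<Rightarrow> complex \<Rightarrow> complex" and K :: "complex \<Rightarrow> real"
  assumes hol: "\<And>n. f n holomorphic_on {s. Re s > c}"
    and K: "continuous_on UNIV K"
    and bound: "\<And>n s. Re s > c \<Longrightarrow> norm (f n s) \<le> K s * real (Suc n) powr (c - 1 - Re s)"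
  shows holomorphic_on_halfplane_series: "(\<lambda>s. \<Sum>n. f n s) holomorphic_on {s. Re s > c}"
    and summable_halfplane_series: "Re s > c \<Longrightarrow> summable (\<lambda>n. f n s)"
proof -
  have summ: "summable (\<lambda>n. norm (f n s))" if "Re s > c" for s
  proof (rule summable_comparison_test')
    show "summable (\<lambda>n. K s * real (Suc n) powr (c - 1 - Re s))"
      using that by (intro summable_mult) (simp add: summable_Suc_powr_iff del: of_nat_Suc)
    show "norm (norm (f n s)) \<le> K s * real (Suc n) powr (c - 1 - Re s)" for n
      using bound[OF that] by simp
  qed
  show "summable (\<lambda>n. f n s)" if "Re s > c"
    by (rule summable_norm_cancel[OF summ[OF that]])
  show "(\<lambda>s. \<Sum>n. f n s) holomorphic_on {s. Re s > c}"
  proof (rule holomorphic_uniform_sequence)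
    show "open {s. Re s > c}" by (rule open_halfspace_Re_gt)
    show "(\<lambda>s. \<Sum>n<N. f n s) holomorphic_on {s. Re s > c}" for N
      by (intro holomorphic_intros hol)
    fix x assume x: "x \<in> {s. Re s > c}"
    define d where "d = (Re x - c) / 2"
    have d: "d > 0" using x by (simp add: d_def)
    have re: "Re y \<ge> c + d" if "y \<in> cball x d" for y
    proof -
      have "\<bar>Re (x - y)\<bar> \<le> d"
        using that abs_Re_le_cmod[of "x - y"] by (simp add: dist_norm)
      thus ?thesis by (simp add: d_def field_simps abs_if split: if_splits)
    qed
    have "bounded (K ` cball x d)"
      by (intro compact_imp_bounded compact_continuous_image continuous_on_subset[OF K]) auto
    then obtain B where "\<forall>y\<in>cball x d. \<bar>K y\<bar> \<le> B"
      by (auto simp: bounded_iff simp del: mem_cball)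
    hence B: "\<bar>K y\<bar> \<le> B" if "y \<in> cball x d" for y using that by blast
    have "uniform_limit (cball x d) (\<lambda>N s. \<Sum>n<N. f n s) (\<lambda>s. \<Sum>n. f n s) sequentially"
    proof (rule Weierstrass_m_test)
      show "summable (\<lambda>n. B * real (Suc n) powr (- 1 - d))"
        using d by (intro summable_mult) (simp add: summable_Suc_powr_iff del: of_nat_Suc)
      fix n y assume y: "y \<in> cball x d"
      have "norm (f n y) \<le> K y * real (Suc n) powr (c - 1 - Re y)"
        using re[OF y] d by (intro bound) auto
      also have "\<dots> \<le> B * real (Suc n) powr (- 1 - d)"
        using B[OF y] re[OF y] by (intro mult_mono powr_mono) auto
      finally show "norm (f n y) \<le> B * real (Suc n) powr (- 1 - d)" .
    qed
    moreover have "cball x d \<subseteq> {s. Re s > c}" using re d by force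
    ultimately show "\<exists>d. 0 < d \<and> cball x d \<subseteq> {s. Re s > c} \<and>
        uniform_limit (cball x d) (\<lambda>N s. \<Sum>n<N. f n s) (\<lambda>s. \<Sum>n. f n s) sequentially"
      using d by blast
  qed
qed

lemma summable_recip_powr: "Re s > 1 \<Longrightarrow> summable (\<lambda>n. recip_powr n s)"
  by (rule summable_halfplane_series[where f = recip_powr and K = "\<lambda>_. 1" and c = 1])
     (auto intro!: holomorphic_intros simp: norm_recip_powr)

lemma holomorphic_on_dirichlet_zeta: "(\<lambda>s. \<Sum>n. recip_powr n s) holomorphic_on {s. Re s > 1}"
  by (rule holomorphic_on_halfplane_series[where K = "\<lambda>_. 1"])
     (auto intro!: holomorphic_intros simp: norm_recip_powr)

section \<open>Analytic continuation of the zeta function\<close>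

text \<open>
  Taylor remainder of order \<open>J\<close> of the function mapping \<open>x\<close> to \<open>x powr (- s)\<close>, expanded at
  \<open>n + 1\<close> and evaluated at \<open>n + 2\<close>; the \<open>j\<close>-th derivative of that function is
  \<open>(-1) ^ j * pochhammer s j * x powr (- s - j)\<close>.
\<close>
definition powr_remainder :: "nat \<Rightarrow> nat \<Rightarrow> complex \<Rightarrow> complex" where
  "powr_remainder J n s = recip_powr (Suc n) s -
     (\<Sum>j\<le>J. (-1) ^ j * pochhammer s j / fact j * recip_powr n (s + of_nat j))"

lemma norm_powr_remainder_le:
  assumes "Re s + real J + 1 \<ge> 0"
  shows "norm (powr_remainder J n s) \<le>
           norm (pochhammer s (Suc J)) * real (Suc n) powr (- Re s - real (Suc J))"
proof -
  define x where "x = real (Suc n)"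
  define S where "S = closed_segment (complex_of_real x) (complex_of_real (x + 1))"
  define f where "f = (\<lambda>i z. (-1) ^ i * pochhammer s i * z powr (- s - of_nat i))"
  have S: "\<exists>t\<ge>x. z = complex_of_real t" if "z \<in> S" for z
    using that unfolding S_def closed_segment_of_real by (auto simp: closed_segment_eq_real_ivl)
  have x: "x > 0" by (simp add: x_def)
  have "norm (f 0 (complex_of_real (x + 1)) - (\<Sum>j\<le>J. f j (complex_of_real x) *
          (complex_of_real (x + 1) - complex_of_real x) ^ j / fact j))
        \<le> norm (pochhammer s (Suc J)) * x powr (- Re s - real (Suc J)) *
          norm (complex_of_real (x + 1) - complex_of_real x) ^ Suc J / fact J"
  proof (rule complex_Taylor[where S = S])
    fix i z assume z: "z \<in> S"
    then obtain t where t: "t \<ge> x" "z = complex_of_real t" using S by blast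
    show "(f i has_field_derivative f (Suc i) z) (at z within S)"
      unfolding f_def using t x
      by (auto intro!: derivative_eq_intros simp: pochhammer_Suc algebra_simps complex_nonpos_Reals_iff)
  next
    fix z assume z: "z \<in> S"
    then obtain t where t: "t \<ge> x" "z = complex_of_real t" using S by blast
    have "norm (f (Suc J) z) = norm (pochhammer s (Suc J)) * t powr (- Re s - real (Suc J))"
      using t x by (simp add: f_def norm_mult norm_power norm_powr_real_powr)
    also have "t powr (- Re s - real (Suc J)) \<le> x powr (- Re s - real (Suc J))"
      using t x assms by (intro powr_mono2') auto
    finally show "norm (f (Suc J) z) \<le> norm (pochhammer s (Suc J)) * x powr (- Re s - real (Suc J))"
      by (simp add: mult_left_mono)
  qed (auto simp: S_def)
  also have "\<dots> \<le> norm (pochhammer s (Suc J)) * x powr (- Re s - real (Suc J))"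
    using mult_left_mono[OF fact_ge_1[of J, where 'a = real],
        of "norm (pochhammer s (Suc J)) * x powr (- Re s - real (Suc J))"]
    by (simp add: divide_le_eq)
  also have "f 0 (complex_of_real (x + 1)) = recip_powr (Suc n) s"
    by (simp add: f_def recip_powr_def x_def add_ac)
  also have "(\<Sum>j\<le>J. f j (complex_of_real x) *
          (complex_of_real (x + 1) - complex_of_real x) ^ j / fact j) =
      (\<Sum>j\<le>J. (-1) ^ j * pochhammer s j / fact j * recip_powr n (s + of_nat j))"
    by (simp add: f_def recip_powr_def x_def algebra_simps)
  finally show ?thesis by (simp add: powr_remainder_def x_def)
qed

text \<open>
  The remainder of order \<open>0\<close> is the first difference.
\<close>
lemma norm_recip_powr_diff_le:
  assumes "Re s > 0"
  shows "norm (recip_powr n s - recip_powr (Suc n) s) \<le> norm s * real (Suc n) powr (- 1 - Re s)"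
proof -
  have eq: "- Re s - real (Suc 0) = - 1 - Re s" by simp
  show ?thesis
    using norm_powr_remainder_le[of s 0 n, unfolded eq] assms
    by (simp add: powr_remainder_def norm_minus_commute)
qed

text \<open>
  The terms of order \<open>0\<close> telescope to \<open>-1\<close>. In the term of order \<open>Suc i\<close> the last factor
  \<open>s + i - 1\<close> of the Pochhammer symbol is split off, because it cancels the pole of the zeta
  function at \<open>s + i\<close>. Thus the identity relates the values at \<open>s, s + 1, s + 2, ...\<close> of the
  function \<open>(s - 1) * \<zeta>(s)\<close>, which will turn out to be entire.
\<close>
lemma powr_remainder_sums:
  assumes "Re s > 1"
  shows "(\<lambda>n. powr_remainder J n (s - 1)) sums
           (- 1 - (\<Sum>i<J. (-1) ^ Suc i * pochhammer (s - 1) i / fact (Suc i) *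
              ((s + of_nat i - 1) * (\<Sum>n. recip_powr n (s + of_nat i)))))"
proof -
  have eq: "powr_remainder J n (s - 1) = (recip_powr (Suc n) (s - 1) - recip_powr n (s - 1)) -
      (\<Sum>i<J. (-1) ^ Suc i * pochhammer (s - 1) i / fact (Suc i) *
         ((s + of_nat i - 1) * recip_powr n (s + of_nat i)))" for n
    unfolding powr_remainder_def
    by (subst sum.atMost_shift) (simp add: pochhammer_Suc algebra_simps add_divide_distrib diff_divide_distrib del: fact_Suc)
  have "(\<lambda>n. recip_powr (Suc n) (s - 1) - recip_powr n (s - 1)) sums (0 - recip_powr 0 (s - 1))"
    using assms by (intro telescope_sums recip_powr_tendsto_0) auto
  moreover have "(\<lambda>n. \<Sum>i<J. (-1) ^ Suc i * pochhammer (s - 1) i / fact (Suc i) *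
         ((s + of_nat i - 1) * recip_powr n (s + of_nat i))) sums
       (\<Sum>i<J. (-1) ^ Suc i * pochhammer (s - 1) i / fact (Suc i) *
         ((s + of_nat i - 1) * (\<Sum>n. recip_powr n (s + of_nat i))))"
    using assms by (intro sums_sum sums_mult summable_sums summable_recip_powr) auto
  ultimately have "(\<lambda>n. powr_remainder J n (s - 1)) sums
     (0 - recip_powr 0 (s - 1) - (\<Sum>i<J. (-1) ^ Suc i * pochhammer (s - 1) i / fact (Suc i) *
              ((s + of_nat i - 1) * (\<Sum>n. recip_powr n (s + of_nat i)))))"
    unfolding eq by (rule sums_diff)
  thus ?thesis by simp
qed

lemma holomorphic_on_pochhammer [holomorphic_intros]:
  "f holomorphic_on S \<Longrightarrow> (\<lambda>s. pochhammer (f s) n) holomorphic_on S"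
  by (induction n) (auto simp: pochhammer_Suc intro!: holomorphic_intros)

text \<open>
  The identity just proved, solved for its term \<open>i = 0\<close>, expresses \<open>(s - 1) * \<zeta>(s)\<close> through
  the same function at points at least one unit further right and through the remainder series,
  which converges for \<open>Re s > 1 - J\<close>. Each use moves the boundary one unit to the left.
\<close>
lemma zeta_continuation_halfplane:
  "\<exists>f. f holomorphic_on {s. Re s > 1 - real N} \<and>
       (\<forall>s. Re s > 1 \<longrightarrow> f s = (s - 1) * (\<Sum>n. recip_powr n s))"
proof (induction N)
  case 0
  have "(\<lambda>s. (s - 1) * (\<Sum>n. recip_powr n s)) holomorphic_on {s. Re s > 1 - real 0}"
    by (intro holomorphic_intros) (simp add: holomorphic_on_dirichlet_zeta)
  thus ?case by blast
next
  case (Suc N)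
  then obtain f where f: "f holomorphic_on {s. Re s > 1 - real N}"
    "\<And>s. Re s > 1 \<Longrightarrow> f s = (s - 1) * (\<Sum>n. recip_powr n s)" by blast
  define A where "A = (\<lambda>i s. (-1) ^ Suc (Suc i) * pochhammer (s - 1) (Suc i) / fact (Suc (Suc i)) *
                         f (s + of_nat (Suc i)))"
  define g where "g = (\<lambda>s. 1 + (\<Sum>n. powr_remainder (Suc N) n (s - 1)) + (\<Sum>i<N. A i s))"
  have "(\<lambda>s. \<Sum>n. powr_remainder (Suc N) n (s - 1)) holomorphic_on {s. Re s > 1 - real (Suc N)}"
  proof (rule holomorphic_on_halfplane_series[where K = "\<lambda>s. norm (pochhammer (s - 1) (Suc (Suc N)))"])
    show "(\<lambda>s. powr_remainder (Suc N) n (s - 1)) holomorphic_on {s. Re s > 1 - real (Suc N)}" for n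
      unfolding powr_remainder_def by (intro holomorphic_intros) auto
    show "continuous_on UNIV (\<lambda>s. norm (pochhammer (s - 1) (Suc (Suc N)) :: complex))"
      by (intro continuous_intros holomorphic_on_imp_continuous_on holomorphic_intros)
    show "norm (powr_remainder (Suc N) n (s - 1)) \<le> norm (pochhammer (s - 1) (Suc (Suc N))) *
            real (Suc n) powr (1 - real (Suc N) - 1 - Re s)" if "Re s > 1 - real (Suc N)" for n s
    proof -
      have eq: "- Re (s - 1) - real (Suc (Suc N)) = 1 - real (Suc N) - 1 - Re s" by simp
      have "Re (s - 1) + real (Suc N) + 1 \<ge> 0" using that by simp
      from norm_powr_remainder_le[OF this, of n, unfolded eq] show ?thesis .
    qed
  qed
  moreover have "A i holomorphic_on {s. Re s > 1 - real (Suc N)}" for i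
  proof -
    have "f \<circ> (\<lambda>s. s + of_nat (Suc i)) holomorphic_on {s. Re s > 1 - real (Suc N)}"
      by (rule holomorphic_on_compose_gen[OF _ f(1)]) (auto intro!: holomorphic_intros)
    thus ?thesis unfolding A_def o_def by (intro holomorphic_intros) auto
  qed
  ultimately have "g holomorphic_on {s. Re s > 1 - real (Suc N)}"
    unfolding g_def by (intro holomorphic_intros)
  moreover have "g s = (s - 1) * (\<Sum>n. recip_powr n s)" if s: "Re s > 1" for s
  proof -
    have "f (s + of_nat (Suc i)) = (s + of_nat (Suc i) - 1) * (\<Sum>n. recip_powr n (s + of_nat (Suc i)))" for i
      using s by (intro f(2)) simp
    thus ?thesis
      unfolding g_def sums_unique[OF powr_remainder_sums[OF s], symmetric] A_def
      by (subst sum.lessThan_Suc_shift) (simp add: sum_negf del: fact_Suc of_nat_Suc)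
  qed
  ultimately show ?case by blast
qed

text \<open>
  The continuations to the various half-planes agree by the identity theorem and glue to an
  entire function; dividing it by \<open>s - 1\<close> gives the zeta function. The index chosen in the
  definition of \<open>Z\<close> merely has to make the half-plane contain \<open>s\<close>.
\<close>
lemma zeta_continuation:
  "\<exists>f. f holomorphic_on - {1} \<and> (\<forall>s. Re s > 1 \<longrightarrow> (\<lambda>n. recip_powr n s) sums f s)"
proof -
  obtain F where F: "\<And>N. F N holomorphic_on {s. Re s > 1 - real N}"
    "\<And>N s. Re s > 1 \<Longrightarrow> F N s = (s - 1) * (\<Sum>n. recip_powr n s)"
    using zeta_continuation_halfplane by metis
  have mono: "F N s = F M s" if "N \<le> M" "Re s > 1 - real N" for N M s
  proof (rule analytic_continuation_open[of "{s. Re s > 1}" "{s. Re s > 1 - real N}" "F N" "F M"])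
    show "{s. Re s > 1} \<noteq> {}" by (auto intro: exI[of _ 2])
    show "connected {s. Re s > 1 - real N}" by (intro convex_connected convex_halfspace_Re_gt)
    show "F M holomorphic_on {s. Re s > 1 - real N}"
      using that by (intro holomorphic_on_subset[OF F(1)]) auto
  qed (use that F in \<open>auto simp: open_halfspace_Re_gt\<close>)
  define Z where "Z = (\<lambda>s. F (nat \<lceil>2 - Re s\<rceil>) s)"
  have Z: "Z s = F N s" if "Re s > 1 - real N" for N s
  proof -
    have "Re s > 1 - real (nat \<lceil>2 - Re s\<rceil>)" by linarith
    thus ?thesis unfolding Z_def
      using mono[of N "nat \<lceil>2 - Re s\<rceil>" s] mono[of "nat \<lceil>2 - Re s\<rceil>" N s] that
      by (cases "N \<le> nat \<lceil>2 - Re s\<rceil>") auto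
  qed
  have "Z holomorphic_on {s. Re s > 1 - real N}" for N
    using F(1)[of N] by (rule holomorphic_transform) (use Z in auto)
  hence "Z holomorphic_on (\<Union>N. {s. Re s > 1 - real N})"
    by (intro holomorphic_on_UN_open) (auto simp: open_halfspace_Re_gt)
  moreover have "(\<Union>N. {s. Re s > 1 - real N}) = UNIV"
  proof -
    have "\<exists>N. Re s > 1 - real N" for s using reals_Archimedean2[of "1 - Re s"] by (force simp: algebra_simps)
    thus ?thesis by blast
  qed
  ultimately have "Z holomorphic_on UNIV" by simp
  hence "(\<lambda>s. Z s / (s - 1)) holomorphic_on - {1}"
    by (intro holomorphic_intros) (auto elim: holomorphic_on_subset)
  moreover have "(\<lambda>n. recip_powr n s) sums (Z s / (s - 1))" if "Re s > 1" for s
  proof -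
    have "Z s = (s - 1) * (\<Sum>n. recip_powr n s)" using Z[of 0 s] F(2)[of s 0] that by simp
    moreover have "s \<noteq> 1" using that by auto
    ultimately show ?thesis using summable_sums[OF summable_recip_powr[OF that]] by simp
  qed
  ultimately show ?thesis by (intro exI[of _ "\<lambda>s. Z s / (s - 1)"]) auto
qed

text \<open>
  The zeta function is introduced by a choice, so the existence of a continuation is what gives
  access to its two characteristic properties.
\<close>
lemma holomorphic_on_riemann_zeta: "riemann_zeta holomorphic_on - {1}"
  and riemann_zeta_sums: "Re s > 1 \<Longrightarrow> (\<lambda>n. recip_powr n s) sums riemann_zeta s"
  using someI_ex[OF zeta_continuation] unfolding riemann_zeta_def recip_powr_def by blast+

section \<open>The zeta function and rounding errors of n/k\<close>
lemma sum_by_parts_lessThan: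
  fixes a f :: "nat \<Rightarrow> 'a :: comm_ring"
  shows "(\<Sum>n<N. a n * f n) = (\<Sum>n<N. (\<Sum>i\<le>n. a i) * (f n - f (Suc n))) + (\<Sum>i<N. a i) * f N"
  by (induction N) (simp_all add: algebra_simps flip: lessThan_Suc_atMost)

lemma sum_dvd_Suc:
  "(\<Sum>i<n. if k dvd Suc i then 1 else 0) = of_nat (n div k)"
  by (induction n) (auto simp: div_Suc mod_eq_0_iff_dvd add.commute)

lemma sums_multiples_iff:
  fixes f :: "nat \<Rightarrow> 'a :: real_normed_vector"
  assumes "k > 0"
  shows "(\<lambda>n. if k dvd Suc n then f (Suc n) else 0) sums c \<longleftrightarrow> (\<lambda>j. f (k * Suc j)) sums c"
proof -
  define g where "g = (\<lambda>j. k * Suc j - 1)"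
  have Suc_g: "Suc (g j) = k * Suc j" for j using assms by (simp add: g_def)
  have mono: "strict_mono g"
    by (rule strict_monoI_Suc) (use Suc_g assms in \<open>simp add: g_def\<close>)
  have zero: "(if k dvd Suc n then f (Suc n) else 0) = 0" if "n \<notin> range g" for n
  proof -
    have "\<not> k dvd Suc n"
    proof
      assume "k dvd Suc n"
      then obtain j where "Suc n = k * j" by blast
      moreover from this obtain i where "j = Suc i" by (cases j) auto
      ultimately have "n = g i" using Suc_g[of i] by simp
      thus False using that by blast
    qed
    thus ?thesis by simp
  qed
  show ?thesis
    using sums_mono_reindex[of g "\<lambda>n. if k dvd Suc n then f (Suc n) else 0" c, OF mono zero]
    unfolding Suc_g by simp
qed

lemma sums_recip_powr_multiples:
  assumes "k > 0" "Re s > 1"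
  shows "(\<lambda>n. (if k dvd Suc n then 1 else 0) * recip_powr n s) sums
           (of_nat k powr (- s) * riemann_zeta s)"
proof -
  have "(\<lambda>j. of_nat (k * Suc j) powr (- s)) sums (of_nat k powr (- s) * riemann_zeta s)"
  proof -
    have "of_nat (k * Suc j) powr (- s) = of_nat k powr (- s) * recip_powr j s" for j
      unfolding recip_powr_def of_nat_mult by (intro powr_times_real) (auto simp del: of_nat_Suc)
    thus ?thesis using sums_mult[OF riemann_zeta_sums[OF assms(2)]] by simp
  qed
  hence "(\<lambda>n. if k dvd Suc n then of_nat (Suc n) powr (- s) else 0) sums
           (of_nat k powr (- s) * riemann_zeta s)"
    by (subst sums_multiples_iff[OF assms(1), of "\<lambda>n. of_nat n powr (- s)"])
  also have "(\<lambda>n. if k dvd Suc n then of_nat (Suc n) powr (- s) else 0) =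
      (\<lambda>n. (if k dvd Suc n then 1 else 0) * recip_powr n s)"
    by (auto simp: recip_powr_def)
  finally show ?thesis .
qed

text \<open>
  The factor \<open>k powr (- s) - 1 / k\<close> vanishes at \<open>s = 1\<close> and cancels the pole. On the level of
  Dirichlet series this means that the coefficients \<open>[k dvd n] - 1 / k\<close> have bounded partial
  sums, namely the rounding errors of \<open>n / k\<close>. For \<open>Re s > 1\<close> the formula is summation by
  parts; its left-hand side converges for \<open>Re s > 0\<close>, and the identity theorem extends it.
\<close>
lemma zeta_floor_series:
  assumes k: "k > 0" and s: "Re s > 0" "s \<noteq> 1"
  shows "(\<lambda>n. (of_nat (Suc n div k) - of_nat (Suc n) / of_nat k) *
              (recip_powr n s - recip_powr (Suc n) s)) sums
         ((of_nat k powr (- s) - 1 / of_nat k) * riemann_zeta s)"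
proof -
  define c :: "nat \<Rightarrow> complex" where "c = (\<lambda>n. of_nat (Suc n div k) - of_nat (Suc n) / of_nat k)"
  define f where "f = (\<lambda>n s. c n * (recip_powr n s - recip_powr (Suc n) s))"
  have c_eq: "c n = - of_nat (Suc n mod k) / of_nat k" for n
  proof -
    have "of_nat (Suc n) = (of_nat k * of_nat (Suc n div k) + of_nat (Suc n mod k) :: complex)"
      by (metis mult_div_mod_eq of_nat_add of_nat_mult)
    thus ?thesis using k by (simp add: c_def field_simps del: of_nat_Suc)
  qed
  have c_le: "norm (c n) \<le> 1" for n
    using k mod_less_divisor[of k "Suc n"] by (simp add: c_eq norm_divide)
  have bound: "norm (f n s) \<le> norm s * real (Suc n) powr (0 - 1 - Re s)" if "Re s > 0" for n s
    using mult_mono[OF c_le[of n] norm_recip_powr_diff_le[OF that, of n]]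
    by (simp add: f_def norm_mult)
  have hol: "f n holomorphic_on S" for n S
    unfolding f_def by (intro holomorphic_intros)
  have summable: "summable (\<lambda>n. f n s)" if "Re s > 0" for s
    by (rule summable_halfplane_series[where f = f and K = norm and c = 0])
       (use that bound hol in \<open>auto intro!: continuous_intros\<close>)
  have holsum: "(\<lambda>s. \<Sum>n. f n s) holomorphic_on {s. Re s > 0}"
    by (rule holomorphic_on_halfplane_series[where f = f and K = norm and c = 0])
       (use bound hol in \<open>auto intro!: continuous_intros\<close>)
  have right: "(\<Sum>n. f n s) = (of_nat k powr (- s) - 1 / of_nat k) * riemann_zeta s"
    if s: "Re s > 1" for s
  proof -
    define a :: "nat \<Rightarrow> complex" where "a = (\<lambda>n. (if k dvd Suc n then 1 else 0) - 1 / of_nat k)"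
    have c: "c n = (\<Sum>i\<le>n. a i)" for n
      by (simp add: c_def a_def sum_subtractf sum_dvd_Suc flip: lessThan_Suc_atMost del: of_nat_Suc sum.lessThan_Suc)
    have "(\<lambda>n. a n * recip_powr n s) sums
        (of_nat k powr (- s) * riemann_zeta s - 1 / of_nat k * riemann_zeta s)"
      using sums_diff[OF sums_recip_powr_multiples[OF k s] sums_mult[OF riemann_zeta_sums[OF s], of "1 / of_nat k"]]
      by (simp add: a_def algebra_simps)
    hence lim: "(\<lambda>N. \<Sum>n<Suc N. a n * recip_powr n s) \<longlonglongrightarrow>
        of_nat k powr (- s) * riemann_zeta s - 1 / of_nat k * riemann_zeta s"
      unfolding sums_def by (rule LIMSEQ_Suc)
    have "(\<lambda>N. c N * recip_powr (Suc N) s) \<longlonglongrightarrow> 0"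
    proof (rule Lim_null_comparison)
      show "\<forall>\<^sub>F N in sequentially. norm (c N * recip_powr (Suc N) s) \<le> norm (recip_powr (Suc N) s)"
        using c_le by (intro always_eventually) (simp add: norm_mult mult_left_le_one_le)
      show "(\<lambda>N. norm (recip_powr (Suc N) s)) \<longlonglongrightarrow> 0"
        using s by (intro tendsto_norm_zero LIMSEQ_Suc recip_powr_tendsto_0) auto
    qed
    moreover have "(\<lambda>N. (\<Sum>n<Suc N. f n s)) \<longlonglongrightarrow> (\<Sum>n. f n s)"
      using summable_LIMSEQ[OF summable[of s]] s by (intro LIMSEQ_Suc) auto
    ultimately have "(\<lambda>N. (\<Sum>n<Suc N. f n s) + c N * recip_powr (Suc N) s) \<longlonglongrightarrow> (\<Sum>n. f n s) + 0"
      by (intro tendsto_add)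
    moreover have "(\<Sum>n<Suc N. f n s) + c N * recip_powr (Suc N) s = (\<Sum>n<Suc N. a n * recip_powr n s)" for N
      using sum_by_parts_lessThan[of a "\<lambda>n. recip_powr n s" "Suc N"]
      by (simp only: f_def c lessThan_Suc_atMost)
    ultimately show ?thesis using LIMSEQ_unique[OF lim] by (simp add: algebra_simps)
  qed
  have "(\<Sum>n. f n s) = (of_nat k powr (- s) - 1 / of_nat k) * riemann_zeta s"
  proof (rule analytic_continuation_open[of "{s. Re s > 1}" "{s. Re s > 0} - {1}" "\<lambda>s. \<Sum>n. f n s"])
    show "{s. Re s > 1} \<noteq> {}" by (auto intro!: exI[of _ 2])
    show "connected ({s. Re s > 0} - {1::complex})"
      by (intro connected_open_delete convex_connected convex_halfspace_Re_gt open_halfspace_Re_gt) auto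
    show "(\<lambda>s. \<Sum>n. f n s) holomorphic_on {s. Re s > 0} - {1}"
      using holsum by (rule holomorphic_on_subset) auto
    show "(\<lambda>s. (of_nat k powr (- s) - 1 / of_nat k) * riemann_zeta s) holomorphic_on {s. Re s > 0} - {1}"
      using k by (intro holomorphic_intros holomorphic_on_subset[OF holomorphic_on_riemann_zeta]) auto
  qed (use s right in \<open>auto simp: open_halfspace_Re_gt intro!: open_delete\<close>)
  thus ?thesis using summable_sums[OF summable[OF s(1)]] by (simp add: f_def c_def)
qed

section \<open>The Moebius function and G\<close>
lemma moebius_mu_mult_prime:
  assumes "prime p" "\<not> p dvd d"
  shows "moebius_mu (p * d) = - moebius_mu d"
proof (cases "d = 0")
  case False
  have cop: "coprime p d" using assms by (simp add: prime_imp_coprime)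
  have "squarefree (p * d) \<longleftrightarrow> squarefree d"
    using cop assms(1) by (auto intro: squarefree_mult_coprime squarefree_prime dest: squarefree_multD)
  moreover have "prime_factors (p * d) = insert p (prime_factors d)"
    using False assms by (simp add: prime_factors_product prime_prime_factors)
  moreover have "p \<notin> prime_factors d" using assms by auto
  ultimately show ?thesis by (simp add: moebius_mu_def)
qed (simp add: moebius_mu_def)

lemma moebius_mu_prime_square:
  assumes "prime p" "p dvd d"
  shows "moebius_mu (p * d) = 0"
proof -
  have "p ^ 2 dvd p * d" using assms by (simp add: power2_eq_square)
  hence "\<not> squarefree (p * d)" using assms by (auto simp: squarefree_def)
  thus ?thesis by (simp add: moebius_mu_def)
qed

text \<open>
  Fix a prime \<open>p\<close> dividing \<open>n\<close>. Multiplication by \<open>p\<close> maps the divisors prime to \<open>p\<close> into the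
  remaining ones with a change of sign, and the divisors that it misses are multiples of \<open>p\<^sup>2\<close>.
\<close>
lemma sum_moebius_mu_dvd:
  assumes "n > 0"
  shows "(\<Sum>d | d dvd n. moebius_mu d) = (if n = 1 then 1 else 0)"
proof (cases "n = 1")
  case True
  thus ?thesis by (simp add: moebius_mu_def)
next
  case False
  then obtain p where p: "prime p" "p dvd n" using prime_factor_nat by blast
  define D where "D = {d. d dvd n \<and> \<not> p dvd d}"
  have fin: "finite {d. d dvd n}" using assms by simp
  have inj: "inj_on ((*) p) {d. d dvd n}" using p by (auto simp: inj_on_def)
  have sub: "(*) p ` D \<subseteq> {d. d dvd n} - D"
    using p by (auto simp: D_def intro!: divides_mult[of p n] prime_imp_coprime)
  have "(\<Sum>d\<in>{d. d dvd n} - D. moebius_mu d) = (\<Sum>d\<in>(*) p ` D. moebius_mu d)"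
  proof (rule sum.mono_neutral_right)
    show "\<forall>d\<in>{d. d dvd n} - D - (*) p ` D. moebius_mu d = 0"
    proof
      fix d assume d: "d \<in> {d. d dvd n} - D - (*) p ` D"
      hence "p dvd d" by (auto simp: D_def)
      then obtain e where e: "d = p * e" by blast
      have "e dvd n" using d e by (auto dest: dvd_mult_right)
      hence "p dvd e" using d e by (auto simp: D_def)
      thus "moebius_mu d = 0" using p e moebius_mu_prime_square by simp
    qed
  qed (use fin sub in auto)
  also have "\<dots> = (\<Sum>d\<in>D. - moebius_mu d)"
    using p by (subst sum.reindex) (auto simp: D_def moebius_mu_mult_prime intro!: inj_onI)
  finally have "(\<Sum>d\<in>{d. d dvd n} - D. moebius_mu d) = - (\<Sum>d\<in>D. moebius_mu d)"
    by (simp add: sum_negf)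
  moreover have "(\<Sum>d | d dvd n. moebius_mu d) =
      (\<Sum>d\<in>{d. d dvd n} - D. moebius_mu d) + (\<Sum>d\<in>D. moebius_mu d)"
    using fin by (intro sum.subset_diff) (auto simp: D_def)
  ultimately show ?thesis using False by simp
qed

lemma abs_moebius_mu_le: "\<bar>real_of_int (moebius_mu n)\<bar> \<le> 1"
  by (simp add: moebius_mu_def power_abs)

lemma sum_moebius_mu_dvd_atMost:
  assumes "0 < n" "n \<le> m"
  shows "(\<Sum>k=1..m. if k dvd n then moebius_mu k else 0) = (if n = 1 then 1 else 0)"
proof -
  have "{k \<in> {1..m}. k dvd n} = {d. d dvd n}"
    using assms dvd_imp_le[of _ n] dvd_pos_nat[of n] by (force simp: Suc_le_eq)
  thus ?thesis using sum_moebius_mu_dvd[OF assms(1)] by (simp flip: sum.inter_filter)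
qed

lemma G_eq_div: "G n m = (\<Sum>k=1..m. moebius_mu k * int (n div k))"
  unfolding G_def by (simp add: floor_divide_of_nat_eq)

lemma G_Suc_left: "G (Suc n) m = G n m + (\<Sum>k=1..m. if k dvd Suc n then moebius_mu k else 0)"
  unfolding G_eq_div sum.distrib[symmetric]
  by (intro sum.cong) (auto simp: div_Suc mod_eq_0_iff_dvd algebra_simps)

text \<open>
  Increasing \<open>n\<close> by one adds to \<open>G n m\<close> the Moebius sum over the divisors of \<open>n + 1\<close>.
\<close>
lemma G_eq_1:
  assumes "1 \<le> n" "n \<le> m"
  shows "G n m = 1"
  using assms
proof (induction n rule: nat_induct_at_least)
  case base
  have "G 0 m = 0" by (simp add: G_eq_div)
  thus ?case using base G_Suc_left[of 0 m] sum_moebius_mu_dvd_atMost[of 1 m] by simp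
next
  case (Suc n)
  thus ?case using G_Suc_left[of n m] sum_moebius_mu_dvd_atMost[of "Suc n" m] by simp
qed

definition moebius_recip_sum :: "nat \<Rightarrow> real" where
  "moebius_recip_sum m = (\<Sum>k=1..m. real_of_int (moebius_mu k) / real k)"

lemma sums_power_multiples:
  assumes "k > 0" "0 < (q::real)" "q < 1"
  shows "(\<lambda>n. if k dvd Suc n then q ^ Suc n else 0) sums (q ^ k / (1 - q ^ k))"
proof -
  have "q ^ k < 1" using assms by (simp add: power_less_one_iff)
  hence "(\<lambda>j. q ^ k * (q ^ k) ^ j) sums (q ^ k * (1 / (1 - q ^ k)))"
    using assms by (intro sums_mult geometric_sums) auto
  thus ?thesis unfolding sums_multiples_iff[OF assms(1), of "\<lambda>n. q ^ n"]
    by (simp add: power_add power_mult)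
qed

section \<open>Sums of mu(k)/k are infinitely often small\<close>

text \<open>
  The classical Lambert series of the Moebius function. Cutting it off after \<open>K\<close> terms before
  expanding in powers of \<open>q\<close> avoids double series: the coefficient of \<open>q ^ n\<close> is a truncated
  divisor sum, which is exact as soon as \<open>K \<ge> n\<close> and is at most \<open>n\<close> in absolute value.
\<close>
lemma moebius_lambert_tendsto:
  assumes q: "0 < q" "q < 1"
  shows "(\<lambda>K. \<Sum>k=1..K. real_of_int (moebius_mu k) * (q ^ k / (1 - q ^ k))) \<longlonglongrightarrow> q"
proof -
  define c where "c = (\<lambda>n K. real_of_int (\<Sum>k=1..K. if k dvd Suc n then moebius_mu k else 0))"
  have sums: "(\<lambda>n. c n K * q ^ Suc n) sums (\<Sum>k=1..K. real_of_int (moebius_mu k) * (q ^ k / (1 - q ^ k)))" for K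
  proof -
    have "(\<lambda>n. \<Sum>k=1..K. real_of_int (moebius_mu k) * (if k dvd Suc n then q ^ Suc n else 0)) sums
        (\<Sum>k=1..K. real_of_int (moebius_mu k) * (q ^ k / (1 - q ^ k)))"
      using q by (intro sums_sum sums_mult sums_power_multiples) auto
    also have "(\<lambda>n. \<Sum>k=1..K. real_of_int (moebius_mu k) * (if k dvd Suc n then q ^ Suc n else 0)) =
        (\<lambda>n. c n K * q ^ Suc n)"
      unfolding c_def of_int_sum sum_distrib_right by (intro ext sum.cong) auto
    finally show ?thesis .
  qed
  have c_le: "\<bar>c n K\<bar> \<le> real (Suc n)" for n K
  proof -
    have "\<bar>c n K\<bar> \<le> (\<Sum>k=1..K. if k dvd Suc n then 1 else 0)"
      unfolding c_def of_int_sum using abs_moebius_mu_le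
      by (intro order_trans[OF sum_abs] sum_mono) auto
    also have "\<dots> = real (card {k \<in> {1..K}. k dvd Suc n})"
      by (simp flip: sum.inter_filter)
    also have "card {k \<in> {1..K}. k dvd Suc n} \<le> card {1..Suc n}"
      using dvd_imp_le[of _ "Suc n"] by (intro card_mono) auto
    finally show ?thesis by simp
  qed
  have "(\<lambda>K. \<Sum>n. c n K * q ^ Suc n) \<longlonglongrightarrow> (\<Sum>n. if n = 0 then q else 0)"
  proof (rule tannerys_theorem[THEN conjunct2, THEN conjunct2])
    show "(\<lambda>K. c n K * q ^ Suc n) \<longlonglongrightarrow> (if n = 0 then q else 0)" for n
    proof (rule tendsto_eventually, rule eventually_mono[OF eventually_ge_at_top[of "Suc n"]])
      show "c n K * q ^ Suc n = (if n = 0 then q else 0)" if "K \<ge> Suc n" for K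
        unfolding c_def sum_moebius_mu_dvd_atMost[OF zero_less_Suc that] by simp
    qed
    show "\<forall>\<^sub>F (n, K) in at_top \<times>\<^sub>F sequentially. norm (c n K * q ^ Suc n) \<le> real (Suc n) * q ^ Suc n"
      using c_le q by (intro always_eventually) (auto simp: abs_mult intro!: mult_right_mono)
    show "summable (\<lambda>n. real (Suc n) * q ^ Suc n)"
    proof -
      have "summable (\<lambda>n. q * (real (Suc n) * q ^ n))"
        using geometric_deriv_sums[of q] q by (intro summable_mult) (auto simp: sums_iff)
      thus ?thesis by (simp add: algebra_simps)
    qed
  qed auto
  also have "(\<Sum>n. if n = 0 then q else 0) = q" using suminf_finite[of "{0::nat}" "\<lambda>n. if n = 0 then q else 0"] by simp
  finally show ?thesis using sums by (simp add: sums_iff)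
qed

text \<open>
  With \<open>q = 1 / Q\<close>, the Lambert series of the Moebius function has the terms
  \<open>moebius_mu k / k * h k\<close>. Writing \<open>Q ^ k - 1\<close> as \<open>(Q - 1) * S k\<close> with a geometric sum \<open>S k\<close>,
  the difference of consecutive weights is
  \<open>(k * Q ^ k - S k) / ((Q - 1) * S k * S (Suc k))\<close>. Both bounds come from comparing the powers
  of \<open>Q\<close> in it with \<open>1\<close> and with \<open>Q ^ k\<close>; in the limit \<open>Q = 1\<close> the difference is \<open>1 / 2\<close>.
\<close>
lemma lambert_weight_diff_bounds:
  fixes Q :: real
  assumes Q: "Q > 1" and k: "k \<ge> 1"
  defines "h \<equiv> \<lambda>k. real k / (Q ^ k - 1)"
  shows "1 / (2 * Q ^ (2 * k)) \<le> h k - h (Suc k)" "h k - h (Suc k) \<le> Q ^ k / 2"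
proof -
  define S where "S = (\<lambda>k. \<Sum>i<k. Q ^ i)"
  have geom: "Q ^ k - 1 = (Q - 1) * S k" for k
    by (simp add: S_def power_diff_1_eq)
  have S_ge: "real k \<le> S k" for k
    using sum_mono[of "{..<k}" "\<lambda>_. 1" "\<lambda>i. Q ^ i"] Q by (simp add: S_def)
  have S_le: "S k \<le> real k * Q ^ k" "S (Suc k) \<le> real (Suc k) * Q ^ k" for k
    using sum_mono[of "{..<k}" "\<lambda>i. Q ^ i" "\<lambda>_. Q ^ k"] sum_mono[of "{..<Suc k}" "\<lambda>i. Q ^ i" "\<lambda>_. Q ^ k"] Q
    by (simp_all add: S_def power_increasing del: sum.lessThan_Suc)
  \<comment> \<open>Both sides of each inequality grow by explicit amounts when \<open>k\<close> increases.\<close>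
  have D: "(Q - 1) * (real k * real (Suc k) / 2) \<le> real k * Q ^ k - S k \<and>
           real k * Q ^ k - S k \<le> (Q - 1) * (real k * real (Suc k) / 2) * Q ^ k"
  proof (induction k)
    case (Suc k)
    have step: "real (Suc k) * Q ^ Suc k - S (Suc k) = (real k * Q ^ k - S k) + (Q - 1) * real (Suc k) * Q ^ k"
      by (simp add: S_def algebra_simps)
    have split: "(Q - 1) * (real (Suc k) * real (Suc (Suc k)) / 2) =
        (Q - 1) * (real k * real (Suc k) / 2) + (Q - 1) * real (Suc k)"
      by (simp add: field_simps)
    have "(Q - 1) * real (Suc k) * 1 \<le> (Q - 1) * real (Suc k) * Q ^ k"
      using Q by (intro mult_left_mono) auto
    moreover have "(Q - 1) * (real (Suc k) * real (Suc (Suc k)) / 2) * Q ^ k \<le>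
        (Q - 1) * (real (Suc k) * real (Suc (Suc k)) / 2) * Q ^ Suc k"
      using Q by (intro mult_left_mono power_increasing) auto
    ultimately show ?case using Suc.IH unfolding step split by (simp only: distrib_right) linarith
  qed (simp add: S_def)
  define P where "P = S k * S (Suc k)"
  have pos: "S k > 0" "S (Suc k) > 0" using S_ge[of k] S_ge[of "Suc k"] k by linarith+
  have P_pos: "P > 0" using pos by (simp add: P_def)
  have P_ge: "real k * real (Suc k) \<le> P"
    unfolding P_def using pos by (intro mult_mono S_ge) auto
  have "P \<le> (real k * Q ^ k) * (real (Suc k) * Q ^ k)"
    unfolding P_def using pos Q by (intro mult_mono S_le) auto
  also have "\<dots> = real k * real (Suc k) * Q ^ (2 * k)"
    by (simp add: mult_2 power_add)
  finally have P_le: "P \<le> real k * real (Suc k) * Q ^ (2 * k)" .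
  define E where "E = (real k * Q ^ k - S k) / (Q - 1)"
  have "h k - h (Suc k) = (real k * ((Q - 1) * S (Suc k)) - real (Suc k) * ((Q - 1) * S k)) /
      (((Q - 1) * S k) * ((Q - 1) * S (Suc k)))"
    unfolding h_def geom using pos Q by (subst diff_frac_eq) auto
  also have "real k * ((Q - 1) * S (Suc k)) - real (Suc k) * ((Q - 1) * S k) =
      (Q - 1) * (real k * Q ^ k - S k)"
    by (simp add: S_def algebra_simps)
  also have "\<dots> / (((Q - 1) * S k) * ((Q - 1) * S (Suc k))) = E / P"
    using Q by (simp add: E_def P_def)
  finally have diff: "h k - h (Suc k) = E / P" .
  have E: "real k * real (Suc k) / 2 \<le> E" "E \<le> real k * real (Suc k) / 2 * Q ^ k"
    using D Q by (simp_all add: E_def field_simps)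
  show "1 / (2 * Q ^ (2 * k)) \<le> h k - h (Suc k)"
  proof -
    have "P / (2 * Q ^ (2 * k)) \<le> real k * real (Suc k) / 2"
      using P_le Q by (simp add: field_simps)
    also note E(1)
    finally show ?thesis using P_pos by (simp add: diff field_simps)
  qed
  show "h k - h (Suc k) \<le> Q ^ k / 2"
  proof -
    have "E \<le> real k * real (Suc k) * (Q ^ k / 2)" using E(2) by simp
    also have "\<dots> \<le> P * (Q ^ k / 2)"
      using Q by (intro mult_right_mono P_ge) auto
    finally show ?thesis using P_pos by (simp add: diff field_simps)
  qed
qed

lemma moebius_recip_sum_Suc:
  "moebius_recip_sum (Suc m) = moebius_recip_sum m + real_of_int (moebius_mu (Suc m)) / real (Suc m)"
  by (simp add: moebius_recip_sum_def)

lemma moebius_recip_sum_eq_lessThan: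
  "moebius_recip_sum m = (\<Sum>n<m. real_of_int (moebius_mu (Suc n)) / real (Suc n))"
  by (induction m) (simp_all add: moebius_recip_sum_Suc, simp add: moebius_recip_sum_def)

text \<open>
  Let \<open>g m\<close> stand for \<open>moebius_recip_sum m\<close> and suppose that \<open>\<bar>g m\<bar> > 1 / (2 * m)\<close> for all large
  \<open>m\<close>. One step changes \<open>g\<close> by at most \<open>1 / (m + 1)\<close>, which is too little to jump over the
  forbidden interval around \<open>0\<close>, so \<open>g\<close> keeps its sign. Summation by parts turns the Lambert
  series into a sum of the values \<open>g k\<close> with positive weights that are at least \<open>1 / 18\<close> for
  \<open>k \<le> N\<close>, where \<open>Q = 1 + 1 / N\<close>. Hence its absolute value is at least
  a constant times the harmonic sum up to \<open>N\<close>, minus a constant. But the Lambert series takes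
  the value \<open>q < 1\<close>.
\<close>
lemma moebius_recip_sum_frequently_small:
  "\<exists>m\<ge>M. real m * \<bar>moebius_recip_sum m\<bar> \<le> 1 / 2"
proof (rule ccontr)
  let ?g = moebius_recip_sum
  assume neg: "\<not> (\<exists>m\<ge>M. real m * \<bar>?g m\<bar> \<le> 1 / 2)"
  define m0 where "m0 = Suc M"
  have large: "1 / (2 * real m) < \<bar>?g m\<bar>" if "m \<ge> m0" for m
  proof -
    have "m \<ge> M" using that by (simp add: m0_def)
    hence "\<not> real m * \<bar>?g m\<bar> \<le> 1 / 2" using neg by blast
    thus ?thesis using that by (simp add: m0_def field_simps)
  qed
  define e where "e = sgn (?g m0)"
  have e: "\<bar>e\<bar> = 1" using large[of m0] by (auto simp: e_def sgn_if m0_def)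
  have signed: "1 / (2 * real m) < e * ?g m" if "m \<ge> m0" for m
    using that
  proof (induction m rule: nat_induct_at_least)
    case base
    thus ?case using large[of m0] by (simp add: e_def sgn_mult_self_eq abs_sgn mult.commute)
  next
    case (Suc m)
    have m: "m > 0" using Suc by (simp add: m0_def)
    define u where "u = 1 / (2 * real (Suc m))"
    have "\<bar>e * (real_of_int (moebius_mu (Suc m)) / real (Suc m))\<bar> \<le> 1 / real (Suc m)"
      using divide_right_mono[OF abs_moebius_mu_le[of "Suc m"], of "real (Suc m)"] e
      by (simp add: abs_mult)
    also have "\<dots> = 2 * u" by (simp add: u_def field_simps)
    finally have "\<bar>e * (real_of_int (moebius_mu (Suc m)) / real (Suc m))\<bar> \<le> 2 * u" .
    moreover have "e * ?g (Suc m) = e * ?g m + e * (real_of_int (moebius_mu (Suc m)) / real (Suc m))"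
      by (simp add: moebius_recip_sum_Suc algebra_simps)
    moreover have "u \<le> 1 / (2 * real m)"
      unfolding u_def using m by (intro divide_left_mono) auto
    moreover have "\<bar>e * ?g (Suc m)\<bar> > u"
      using large[of "Suc m"] Suc e by (simp add: abs_mult u_def)
    ultimately have "e * ?g (Suc m) > u" using Suc.IH by linarith
    thus ?case by (simp add: u_def)
  qed
  have nonneg: "0 \<le> e * ?g m" if "m \<ge> m0" for m
  proof -
    have "0 \<le> 1 / (2 * real m)" by simp
    with signed[OF that] show ?thesis by linarith
  qed
  define B where "B = (\<Sum>n<m0. \<bar>?g (Suc n)\<bar> * 2 ^ Suc n / 2)"
  have bound: "(\<Sum>n=m0..<N. 1 / real (Suc n)) \<le> 36 * (1 + B)" if N: "N \<ge> m0" for N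
  proof -
    have N0: "N > 0" using N by (simp add: m0_def)
    \<comment> \<open>Close enough to \<open>1\<close> that \<open>Q ^ (2 * N) \<le> 9\<close>.\<close>
    define Q where "Q = 1 + 1 / real N"
    have Q: "Q > 1" "Q \<le> 2" using N0 by (auto simp: Q_def field_simps)
    define h where "h = (\<lambda>k. real k / (Q ^ k - 1))"
    have h: "1 / (2 * Q ^ (2 * k)) \<le> h k - h (Suc k)" "h k - h (Suc k) \<le> Q ^ k / 2" if "k \<ge> 1" for k
      using lambert_weight_diff_bounds[OF Q(1) that] unfolding h_def by auto
    have h_nonneg: "h k \<ge> 0" for k using Q by (simp add: h_def)
    have h_decr: "h (Suc n) - h (Suc (Suc n)) \<ge> 0" for n
      using Q by (intro order_trans[OF _ h(1)]) auto
    \<comment> \<open>The initial terms, of unknown sign, are bounded independently of \<open>N\<close> because \<open>Q \<le> 2\<close>.\<close>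
    have head: "- (\<bar>?g (Suc n)\<bar> * 2 ^ Suc n / 2) \<le> e * ?g (Suc n) * (h (Suc n) - h (Suc (Suc n)))" for n
    proof -
      have "\<bar>e * ?g (Suc n) * (h (Suc n) - h (Suc (Suc n)))\<bar> = \<bar>?g (Suc n)\<bar> * (h (Suc n) - h (Suc (Suc n)))"
        using h_decr[of n] e by (simp add: abs_mult)
      also have "\<dots> \<le> \<bar>?g (Suc n)\<bar> * (2 ^ Suc n / 2)"
        using Q by (intro mult_left_mono order_trans[OF h(2)] divide_right_mono power_mono) auto
      finally show ?thesis by simp
    qed
    have mid: "1 / real (Suc n) / 36 \<le> e * ?g (Suc n) * (h (Suc n) - h (Suc (Suc n)))"
      if n: "n \<ge> m0" "n < N" for n
    proof -
      have "Q ^ (2 * Suc n) \<le> Q ^ (2 * N)" using n Q by (intro power_increasing) auto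
      also have "\<dots> \<le> exp (1 / real N) ^ (2 * N)"
        unfolding Q_def by (intro power_mono exp_ge_add_one_self) auto
      also have "\<dots> = exp 1 ^ 2" using N0 by (simp flip: exp_of_nat_mult)
      also have "\<dots> \<le> 3 ^ 2" by (intro power_mono exp_le) auto
      finally have "1 / 18 \<le> 1 / (2 * Q ^ (2 * Suc n))"
        using Q by (simp add: field_simps)
      also have "\<dots> \<le> h (Suc n) - h (Suc (Suc n))" by (rule h) simp
      finally have "1 / (2 * real (Suc n)) * (1 / 18) \<le> e * ?g (Suc n) * (h (Suc n) - h (Suc (Suc n)))"
        using signed[of "Suc n"] nonneg[of "Suc n"] n by (intro mult_mono) auto
      thus ?thesis by (simp add: mult.commute)
    qed
    define T where "T = (\<Sum>n=m0..<N. 1 / real (Suc n)) / 36"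
    have partial: "- B + T \<le> e * (\<Sum>k=1..K. real_of_int (moebius_mu k) * ((1 / Q) ^ k / (1 - (1 / Q) ^ k)))"
      if K: "K \<ge> N" for K
    proof -
      have "(1 / Q) ^ k / (1 - (1 / Q) ^ k) = h k / real k" if "k \<ge> 1" for k
      proof -
        define x where "x = Q ^ k"
        have "x > 1" unfolding x_def using Q that by (intro one_less_power) auto
        hence "1 / x / (1 - 1 / x) = 1 / (x - 1)" by (simp add: field_simps)
        thus ?thesis using that by (simp add: h_def x_def power_one_over)
      qed
      hence "(\<Sum>k=1..K. real_of_int (moebius_mu k) * ((1 / Q) ^ k / (1 - (1 / Q) ^ k))) =
          (\<Sum>k=1..K. real_of_int (moebius_mu k) / real k * h k)"
        by (intro sum.cong) auto
      also have "\<dots> = (\<Sum>n<K. real_of_int (moebius_mu (Suc n)) / real (Suc n) * h (Suc n))"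
        by (rule sum.reindex_bij_witness[of _ Suc "\<lambda>k. k - 1"]) auto
      also have "\<dots> = (\<Sum>n<K. ?g (Suc n) * (h (Suc n) - h (Suc (Suc n)))) + ?g K * h (Suc K)"
        by (subst sum_by_parts_lessThan) (simp only: moebius_recip_sum_eq_lessThan lessThan_Suc_atMost)
      finally have eq: "e * (\<Sum>k=1..K. real_of_int (moebius_mu k) * ((1 / Q) ^ k / (1 - (1 / Q) ^ k))) =
          (\<Sum>n<K. e * ?g (Suc n) * (h (Suc n) - h (Suc (Suc n)))) + e * ?g K * h (Suc K)"
        by (simp add: sum_distrib_left algebra_simps)
      have "(\<Sum>n<K. e * ?g (Suc n) * (h (Suc n) - h (Suc (Suc n)))) =
          (\<Sum>n<m0. e * ?g (Suc n) * (h (Suc n) - h (Suc (Suc n)))) +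
          (\<Sum>n=m0..<N. e * ?g (Suc n) * (h (Suc n) - h (Suc (Suc n)))) +
          (\<Sum>n=N..<K. e * ?g (Suc n) * (h (Suc n) - h (Suc (Suc n))))"
        using K N by (simp add: lessThan_atLeast0 sum.atLeastLessThan_concat)
      moreover have "- B \<le> (\<Sum>n<m0. e * ?g (Suc n) * (h (Suc n) - h (Suc (Suc n))))"
        unfolding B_def sum_negf[symmetric] by (intro sum_mono head)
      moreover have "T \<le> (\<Sum>n=m0..<N. e * ?g (Suc n) * (h (Suc n) - h (Suc (Suc n))))"
        unfolding T_def sum_divide_distrib by (intro sum_mono mid) auto
      moreover have "0 \<le> (\<Sum>n=N..<K. e * ?g (Suc n) * (h (Suc n) - h (Suc (Suc n))))"
        using N by (intro sum_nonneg mult_nonneg_nonneg nonneg h_decr) auto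
      moreover have "0 \<le> e * ?g K * h (Suc K)"
        using N K by (intro mult_nonneg_nonneg nonneg h_nonneg) auto
      ultimately show ?thesis unfolding eq by linarith
    qed
    have "- B + T \<le> e * (1 / Q)"
    proof (rule tendsto_lowerbound)
      show "(\<lambda>K. e * (\<Sum>k=1..K. real_of_int (moebius_mu k) * ((1 / Q) ^ k / (1 - (1 / Q) ^ k)))) \<longlonglongrightarrow> e * (1 / Q)"
        using Q by (intro tendsto_mult_left moebius_lambert_tendsto) auto
    qed (use partial in \<open>auto intro: eventually_mono[OF eventually_ge_at_top[of N]]\<close>)
    moreover have "\<bar>e * (1 / Q)\<bar> \<le> 1" using Q e by (simp add: abs_mult)
    ultimately have "T \<le> 1 + B" by linarith
    thus ?thesis by (simp add: T_def)
  qed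
  have "harm N \<le> (harm m0 + 36 * (1 + B) :: real)" if "N \<ge> m0" for N
  proof -
    have "harm N = (\<Sum>n<N. 1 / real (Suc n))"
      by (induction N) (simp_all add: harm_Suc harm_expand(1) inverse_eq_divide)
    moreover have "harm m0 = (\<Sum>n<m0. 1 / real (Suc n))"
      by (induction m0) (simp_all add: harm_Suc harm_expand(1) inverse_eq_divide)
    ultimately have "harm N = harm m0 + (\<Sum>n=m0..<N. 1 / real (Suc n))"
      using that by (simp add: lessThan_atLeast0 sum.atLeastLessThan_concat)
    thus ?thesis using bound[OF that] by simp
  qed
  moreover have "eventually (\<lambda>N. harm N > (harm m0 + 36 * (1 + B) :: real)) sequentially"
    using harm_at_top by (simp add: filterlim_at_top_dense)
  ultimately have "eventually (\<lambda>N. N \<ge> m0 \<longrightarrow> False) sequentially"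
    by (auto elim!: eventually_mono simp: not_le[symmetric])
  thus False unfolding eventually_sequentially by (meson linear order_trans le_refl)
qed

section \<open>Absence of zeros\<close>
lemma G_minus_linear:
  "real_of_int (G n m) - real n * moebius_recip_sum m =
     (\<Sum>k=1..m. real_of_int (moebius_mu k) * (real (n div k) - real n / real k))"
  unfolding G_eq_div moebius_recip_sum_def
  by (simp add: sum_subtractf sum_distrib_left algebra_simps)

lemma abs_G_minus_linear_le: "\<bar>real_of_int (G n m) - real n * moebius_recip_sum m\<bar> \<le> real m"
proof -
  have "\<bar>real_of_int (moebius_mu k) * (real (n div k) - real n / real k)\<bar> \<le> 1" if "k \<in> {1..m}" for k
  proof -
    have "\<bar>real (n div k) - real n / real k\<bar> \<le> 1"
      using floor_divide_of_nat_eq[of n k, where 'a = real] by linarith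
    thus ?thesis using abs_moebius_mu_le[of k] unfolding abs_mult by (intro mult_le_one) auto
  qed
  hence "(\<Sum>k=1..m. \<bar>real_of_int (moebius_mu k) * (real (n div k) - real n / real k)\<bar>) \<le> real (card {1..m}) * 1"
    by (intro sum_bounded_above)
  thus ?thesis unfolding G_minus_linear by (intro order_trans[OF sum_abs]) simp
qed

text \<open>
  A linear combination of the series for \<open>k powr (- s) - 1 / k\<close> times zeta, which vanish
  simultaneously at a zero.
\<close>
lemma G_series_at_zeta_zero:
  assumes "Re s > 0" "s \<noteq> 1" "riemann_zeta s = 0"
  shows "(\<lambda>n. of_real (real_of_int (G (Suc n) m) - real (Suc n) * moebius_recip_sum m) *
            (recip_powr n s - recip_powr (Suc n) s)) sums 0"
proof -
  have "(\<lambda>n. \<Sum>k=1..m. of_int (moebius_mu k) * ((of_nat (Suc n div k) - of_nat (Suc n) / of_nat k) *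
              (recip_powr n s - recip_powr (Suc n) s))) sums
        (\<Sum>k=1..m. of_int (moebius_mu k) * ((of_nat k powr (- s) - 1 / of_nat k) * riemann_zeta s))"
    using assms by (intro sums_sum sums_mult zeta_floor_series) auto
  thus ?thesis
    unfolding G_minus_linear using assms(3)
    by (simp add: sum_distrib_right mult.assoc del: of_nat_Suc)
qed

text \<open>
  A bound that depends on \<open>n\<close> only and not on \<open>m\<close>, with three different reasons. For \<open>n \<le> m\<close>
  the value of \<open>G\<close> is \<open>1\<close>. For \<open>m < n < m powr (1 / \<sigma>)\<close> the inequality \<open>n powr \<sigma> < m\<close> holds, hence
  \<open>n / m \<le> n powr (1 - \<sigma>)\<close>, so that each of the three terms of the hypothesis, and also
  \<open>n / m\<close> itself because of \<open>1 - \<sigma> \<le> \<sigma>\<close>, is at most \<open>n powr \<sigma>\<close>. Beyond that range the trivial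
  bound \<open>m\<close> for the rounding errors is at most \<open>n powr \<sigma>\<close>.
\<close>
lemma G_error_bound:
  fixes \<sigma> C :: real and n m :: nat
  defines "A \<equiv> real_of_int (G n m) - real n * moebius_recip_sum m"
  assumes \<sigma>: "1/2 \<le> \<sigma>" "\<sigma> < 1" and C: "C \<ge> 0"
    and m: "m \<ge> 3" "real m * \<bar>moebius_recip_sum m\<bar> \<le> 1 / 2" and n: "n \<ge> 1"
    and hyp: "m < n \<Longrightarrow> real n < real m powr (1/\<sigma>) \<Longrightarrow>
      \<bar>real_of_int (G n m)\<bar> \<le> (real m powr \<sigma> + real n powr \<sigma> / sqrt (ln (real n))
                 + (real n / real m) powr (\<sigma> / (1 - \<sigma>))) * C"
  shows "\<bar>A\<bar> \<le> (3 * C + 2) * real n powr \<sigma>"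
proof -
  have n1: "1 \<le> real n powr \<sigma>" using n \<sigma> by (intro ge_one_powr_ge_zero) auto
  have g: "\<bar>real n * moebius_recip_sum m\<bar> \<le> real n / real m"
  proof -
    have "\<bar>moebius_recip_sum m\<bar> \<le> 1 / real m" using m by (simp add: field_simps)
    from mult_left_mono[OF this, of "real n"] show ?thesis by (simp add: abs_mult)
  qed
  consider "n \<le> m" | "m < n" "real n < real m powr (1/\<sigma>)" | "real m powr (1/\<sigma>) \<le> real n"
    by linarith
  thus ?thesis
  proof cases
    case 1
    hence "real n / real m \<le> 1" using m by (simp add: field_simps)
    moreover have "\<bar>real_of_int (G n m)\<bar> = 1" using G_eq_1[OF n 1] by simp
    ultimately have "\<bar>A\<bar> \<le> 2 * 1" using g unfolding A_def by linarith
    also have "\<dots> \<le> (3 * C + 2) * real n powr \<sigma>" using C n1 by (intro mult_mono) auto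
    finally show ?thesis .
  next
    case 2
    have n_less: "real n powr \<sigma> < real m"
    proof -
      have "real n powr \<sigma> < (real m powr (1/\<sigma>)) powr \<sigma>"
        using 2 \<sigma> by (intro powr_less_mono2) auto
      also have "\<dots> = real m" using \<sigma> m by (simp add: powr_powr)
      finally show ?thesis .
    qed
    have ratio: "real n / real m \<le> real n powr (1 - \<sigma>)"
    proof -
      have "real n / real m \<le> real n / real n powr \<sigma>"
        using n_less n m by (intro divide_left_mono mult_pos_pos) auto
      also have "\<dots> = real n powr (1 - \<sigma>)" using n by (simp add: powr_diff)
      finally show ?thesis .
    qed
    have "real m powr \<sigma> \<le> real n powr \<sigma>" using 2 \<sigma> by (intro powr_mono2) auto
    moreover have "real n powr \<sigma> / sqrt (ln (real n)) \<le> real n powr \<sigma>"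
    proof -
      \<comment> \<open>The denominator is harmless once \<open>n \<ge> 3\<close>, which is why \<open>m \<ge> 3\<close> is demanded.\<close>
      have "exp 1 \<le> real n" using exp_le 2 m by linarith
      hence "ln (real n) \<ge> 1" using n by (subst ln_ge_iff) auto
      hence "sqrt (ln (real n)) \<ge> 1" by simp
      thus ?thesis by (simp add: divide_le_eq mult_le_cancel_left1)
    qed
    moreover have "(real n / real m) powr (\<sigma> / (1 - \<sigma>)) \<le> real n powr \<sigma>"
    proof -
      have "(real n / real m) powr (\<sigma> / (1 - \<sigma>)) \<le> (real n powr (1 - \<sigma>)) powr (\<sigma> / (1 - \<sigma>))"
        using ratio \<sigma> by (intro powr_mono2) auto
      thus ?thesis using \<sigma> by (simp add: powr_powr)
    qed
    ultimately have "(real m powr \<sigma> + real n powr \<sigma> / sqrt (ln (real n))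
                 + (real n / real m) powr (\<sigma> / (1 - \<sigma>))) * C \<le> (3 * real n powr \<sigma>) * C"
      using C by (intro mult_right_mono) auto
    with hyp[OF 2] have "\<bar>real_of_int (G n m)\<bar> \<le> 3 * C * real n powr \<sigma>" by (simp add: mult_ac)
    moreover have "real n powr (1 - \<sigma>) \<le> real n powr \<sigma>" using \<sigma> n by (intro powr_mono) auto
    ultimately have "\<bar>A\<bar> \<le> 3 * C * real n powr \<sigma> + real n powr \<sigma>"
      using g ratio unfolding A_def by linarith
    also have "\<dots> \<le> (3 * C + 2) * real n powr \<sigma>" by (simp add: algebra_simps)
    finally show ?thesis .
  next
    case 3
    have "real m = (real m powr (1/\<sigma>)) powr \<sigma>" using \<sigma> m by (simp add: powr_powr)
    also have "\<dots> \<le> real n powr \<sigma>" using 3 \<sigma> by (intro powr_mono2) auto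
    finally have "\<bar>A\<bar> \<le> 1 * real n powr \<sigma>"
      using abs_G_minus_linear_le[of n m] unfolding A_def by simp
    also have "\<dots> \<le> (3 * C + 2) * real n powr \<sigma>" using C by (intro mult_right_mono) auto
    finally show ?thesis .
  qed
qed

text \<open>
  At a zero \<open>s\<close> the series of \<open>A n i * D n\<close> vanishes for every \<open>i\<close>. As \<open>i\<close> tends to infinity,
  the coefficients \<open>A n i\<close> tend to \<open>1\<close>, and the terms are dominated by a multiple of
  \<open>n powr (\<sigma> - 1 - Re s)\<close>, which is summable exactly when \<open>Re s > \<sigma>\<close>. The limit series
  telescopes to \<open>1\<close>.
\<close>
lemma zeta_nonzero_if_G_bound:
  fixes \<sigma> C :: real
  assumes \<sigma>: "1/2 \<le> \<sigma>" "\<sigma> < 1" and C: "C \<ge> 0"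
    and hyp: "\<And>m n. m \<ge> 1 \<Longrightarrow> real m * \<bar>moebius_recip_sum m\<bar> \<le> 1 / 2 \<Longrightarrow> m < n \<Longrightarrow>
      real n < real m powr (1/\<sigma>) \<Longrightarrow>
      \<bar>real_of_int (G n m)\<bar> \<le> (real m powr \<sigma> + real n powr \<sigma> / sqrt (ln (real n))
                 + (real n / real m) powr (\<sigma> / (1 - \<sigma>))) * C"
    and s: "Re s > \<sigma>" "s \<noteq> 1"
  shows "riemann_zeta s \<noteq> 0"
proof
  assume zero: "riemann_zeta s = 0"
  have s0: "Re s > 0" using s \<sigma> by linarith
  have "\<forall>i. \<exists>m. i + 3 \<le> m \<and> real m * \<bar>moebius_recip_sum m\<bar> \<le> 1 / 2"
    using moebius_recip_sum_frequently_small by blast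
  then obtain r where r: "\<And>i. i + 3 \<le> r i" "\<And>i. real (r i) * \<bar>moebius_recip_sum (r i)\<bar> \<le> 1 / 2"
    by metis
  define A where "A = (\<lambda>n i. real_of_int (G (Suc n) (r i)) - real (Suc n) * moebius_recip_sum (r i))"
  define D where "D = (\<lambda>n. recip_powr n s - recip_powr (Suc n) s)"
  have A_lim: "(\<lambda>i. A n i) \<longlonglongrightarrow> 1" for n
  proof -
    have "(\<lambda>i. 1 - A n i) \<longlonglongrightarrow> 0"
    proof (rule Lim_null_comparison)
      have "norm (1 - A n i) \<le> real (Suc n) * inverse (real i)" if i: "i \<ge> Suc n" for i
      proof -
        have "G (Suc n) (r i) = 1" using r(1)[of i] i by (intro G_eq_1) auto
        hence "norm (1 - A n i) = real (Suc n) * \<bar>moebius_recip_sum (r i)\<bar>"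
          by (simp add: A_def abs_mult)
        also have "\<bar>moebius_recip_sum (r i)\<bar> \<le> inverse (real i)"
        proof -
          have "real i * \<bar>moebius_recip_sum (r i)\<bar> \<le> real (r i) * \<bar>moebius_recip_sum (r i)\<bar>"
            using r(1)[of i] by (intro mult_right_mono) auto
          also have "\<dots> \<le> 1" using r(2)[of i] by simp
          finally show ?thesis using i by (simp add: field_simps)
        qed
        finally show ?thesis by (simp add: mult_left_mono)
      qed
      thus "\<forall>\<^sub>F i in sequentially. norm (1 - A n i) \<le> real (Suc n) * inverse (real i)"
        by (intro eventually_mono[OF eventually_ge_at_top[of "Suc n"]])
      show "(\<lambda>i. real (Suc n) * inverse (real i)) \<longlonglongrightarrow> 0"
        by (intro tendsto_mult_right_zero lim_inverse_n)
    qed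
    from tendsto_diff[OF tendsto_const[of 1] this] show ?thesis by simp
  qed
  have A_le: "\<bar>A n i\<bar> \<le> (3 * C + 2) * real (Suc n) powr \<sigma>" for n i
    unfolding A_def using r(1)[of i] by (intro G_error_bound \<sigma> C r hyp) auto
  have "(\<lambda>i. \<Sum>n. of_real (A n i) * D n) \<longlonglongrightarrow> (\<Sum>n. D n)"
  proof (rule tannerys_theorem[THEN conjunct2, THEN conjunct2])
    show "(\<lambda>i. of_real (A n i) * D n) \<longlonglongrightarrow> D n" for n
      using tendsto_mult_right[OF tendsto_of_real[OF A_lim[of n]], of "D n"] by simp
    have "norm (of_real (A n i) * D n) \<le>
        (3 * C + 2) * norm s * real (Suc n) powr (\<sigma> - 1 - Re s)" for n i
    proof -
      have "norm (of_real (A n i) * D n) \<le>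
          ((3 * C + 2) * real (Suc n) powr \<sigma>) * (norm s * real (Suc n) powr (- 1 - Re s))"
        unfolding norm_mult D_def using A_le[of n i] norm_recip_powr_diff_le[OF s0, of n]
        by (intro mult_mono) auto
      also have "\<dots> = (3 * C + 2) * norm s * (real (Suc n) powr \<sigma> * real (Suc n) powr (- 1 - Re s))"
        by (simp only: mult_ac)
      also have "real (Suc n) powr \<sigma> * real (Suc n) powr (- 1 - Re s) = real (Suc n) powr (\<sigma> - 1 - Re s)"
        by (simp flip: powr_add add: algebra_simps)
      finally show ?thesis .
    qed
    thus "\<forall>\<^sub>F (n, i) in at_top \<times>\<^sub>F sequentially. norm (of_real (A n i) * D n) \<le>
        (3 * C + 2) * norm s * real (Suc n) powr (\<sigma> - 1 - Re s)"
      by (intro always_eventually) auto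
    show "summable (\<lambda>n. (3 * C + 2) * norm s * real (Suc n) powr (\<sigma> - 1 - Re s))"
      using s by (intro summable_mult) (simp add: summable_Suc_powr_iff del: of_nat_Suc)
  qed auto
  moreover have "(\<Sum>n. of_real (A n i) * D n) = 0" for i
    using G_series_at_zeta_zero[OF s0 s(2) zero, of "r i"] unfolding A_def D_def by (rule sums_unique[symmetric])
  moreover have "(\<Sum>n. D n) = 1"
  proof -
    have "D sums (recip_powr 0 s - 0)"
      unfolding D_def by (rule telescope_sums'[OF recip_powr_tendsto_0[OF s0]])
    thus ?thesis by (simp add: sums_iff)
  qed
  ultimately have "(\<lambda>i::nat. 0::complex) \<longlonglongrightarrow> 1" by simp
  thus False by (simp add: LIMSEQ_const_iff)
qed

theorem theorem3p1:
  fixes \<sigma> :: real and \<omega> :: "real \<Rightarrow> ennreal"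
  assumes "1/2 \<le> \<sigma>" and "\<sigma> < 1"
    and "mono_on {0..} \<omega>"
    and "\<omega> (1/2) < \<infinity>"
    and "\<And>m n :: nat. m \<ge> 1 \<Longrightarrow> m < n \<Longrightarrow> real n < real m powr (1/\<sigma>) \<Longrightarrow>
      ennreal (real_of_int \<bar>G n m\<bar>) \<le>
        ennreal (real m powr \<sigma> + real n powr \<sigma> / sqrt (ln (real n))
                 + (real n / real m) powr (\<sigma> / (1 - \<sigma>)))
        * \<omega> (real m * \<bar>\<Sum>k=1..m. real_of_int (moebius_mu k) / real k\<bar>)"
  shows "\<forall>s::complex. Re s > \<sigma> \<and> s \<noteq> 1 \<longrightarrow> riemann_zeta s \<noteq> 0"
proof (intro allI impI)
  fix s :: complex
  assume s: "Re s > \<sigma> \<and> s \<noteq> 1"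
  \<comment> \<open>By monotonicity the value at \<open>1 / 2\<close> serves for all \<open>m\<close> with \<open>m * \<bar>g m\<bar> \<le> 1 / 2\<close>.\<close>
  define C where "C = enn2real (\<omega> (1/2))"
  have C: "C \<ge> 0" "\<omega> (1/2) = ennreal C"
    using assms(4) by (auto simp: C_def ennreal_enn2real_if)
  show "riemann_zeta s \<noteq> 0"
  proof (rule zeta_nonzero_if_G_bound[OF assms(1,2) C(1)])
    fix m n :: nat
    assume mn: "m \<ge> 1" "real m * \<bar>moebius_recip_sum m\<bar> \<le> 1 / 2" "m < n" "real n < real m powr (1/\<sigma>)"
    define b where "b = real m powr \<sigma> + real n powr \<sigma> / sqrt (ln (real n))
                 + (real n / real m) powr (\<sigma> / (1 - \<sigma>))"
    have b: "b \<ge> 0" unfolding b_def using mn by (intro add_nonneg_nonneg divide_nonneg_nonneg) auto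
    have "ennreal (real_of_int \<bar>G n m\<bar>) \<le> ennreal b * \<omega> (real m * \<bar>moebius_recip_sum m\<bar>)"
      using assms(5)[OF mn(1,3,4)] by (simp add: b_def moebius_recip_sum_def)
    also have "\<omega> (real m * \<bar>moebius_recip_sum m\<bar>) \<le> \<omega> (1/2)"
      using mn(2) by (intro mono_onD[OF assms(3)]) auto
    finally have "ennreal (real_of_int \<bar>G n m\<bar>) \<le> ennreal b * \<omega> (1/2)"
      by (simp add: mult_left_mono)
    also have "\<dots> = ennreal (b * C)"
      using b C by (simp add: ennreal_mult)
    finally show "\<bar>real_of_int (G n m)\<bar> \<le> (real m powr \<sigma> + real n powr \<sigma> / sqrt (ln (real n))
                 + (real n / real m) powr (\<sigma> / (1 - \<sigma>))) * C"
      using b C by (simp add: b_def ennreal_le_iff)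
  qed (use s in auto)
qed

end
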